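(* Let $N\ge2$, $\omega_L,\omega_R>0$, and let $(\xi_t)_{t\ge0}$ be the dual boundary driven symmetric exclusion process on the segment $[N-1]$ with $\omega_{x,x+1}=1$ for $x\in\{1,\dots,N-2\}$ and absorption rates $\omega_L$ (from $1$ to $0$) and $\omega_R$ (from $N-1$ to $N$). Let $h:\{0,\dots,N\}\to\mathbb R$ be given by $h(0)=0$, $h(x)=\frac1{\omega_L}+x-1$ for $x\in\{1,\dots,N-1\}$, and $h(N)=\frac1{\omega_L}+\frac1{\omega_R}+N-2$. Then for all integers $1\le x_1<\dots<x_k\le N-1$, $$\hat{\mathbb P}_{\{x_1,\dots,x_k\}}\big[\xi_\infty(N)=k\big]=\prod_{i=1}^k\frac{h(x_i)-(i-1)}{h(N)-(i-1)}.$$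
   Context: $[N-1]:=\{1,\dots,N-1\}$. The dual boundary driven symmetric exclusion process on the segment is the Markov process $(\xi_t)_{t\ge0}$ on $\hat{\mathcal X}=\mathbb N_0^{\{0\}}\times\{0,1\}^{[N-1]}\times\mathbb N_0^{\{N\}}$ with generator $$\hat{\mathcal L}f(\xi)=\sum_{x=1}^{N-2}\big\{\xi(x)(1-\xi(x+1))(f(\xi^{x,x+1})-f(\xi))+\xi(x+1)(1-\xi(x))(f(\xi^{x+1,x})-f(\xi))\big\}$$ $$+\ \omega_L\,\xi(1)(f(\xi^{1,0})-f(\xi))+\omega_R\,\xi(N-1)(f(\xi^{N-1,N})-f(\xi)),$$ where $\xi^{x,y}$ is $\xi$ with one particle moved from $x$ to $y$. The sites $0,N$ are absorbing. For $J\subset[N-1]$, $\hat{\mathbb P}_J$ is the law of the process started from $\xi_0(x)=\mathbf 1_{\{x\in J\}}$. All particles are eventually absorbed almost surely, and $\xi_\infty:=\lim_{t\to\infty}\xi_t$; $\xi_\infty(N)$ is the number of particles absorbed at $N$. *)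

theory Defs
  imports "HOL-Probability.Probability"
begin

section \<open>Continuous-time Markov processes on a countable discrete state space\<close>

definition markov_semigroup :: "'s set \<Rightarrow> (real \<Rightarrow> 's \<Rightarrow> 's pmf) \<Rightarrow> bool" where
  "markov_semigroup S P \<longleftrightarrow>
     (\<forall>t\<ge>0. \<forall>x\<in>S. set_pmf (P t x) \<subseteq> S) \<and>
     (\<forall>x\<in>S. P 0 x = return_pmf x) \<and>
     (\<forall>s\<ge>0. \<forall>t\<ge>0. \<forall>x\<in>S. P (s + t) x = bind_pmf (P s x) (P t))"

text \<open>
  The infinitesimal generator, as the derivative at time 0 in the supremum norm. It is required to
  exist on all bounded functions, so this notion is meant for generators with bounded jump rates.
\<close>

definition has_generator ::
    "'s set \<Rightarrow> (real \<Rightarrow> 's \<Rightarrow> 's pmf) \<Rightarrow> (('s \<Rightarrow> real) \<Rightarrow> 's \<Rightarrow> real) \<Rightarrow> bool" where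
  "has_generator S P L \<longleftrightarrow>
     (\<forall>f. bounded (f ` S) \<longrightarrow>
        uniform_limit S (\<lambda>t x. (measure_pmf.expectation (P t x) f - f x) / t) (L f) (at_right 0))"

text \<open>
  The Markov property, in its elementary form for discrete state spaces: \<open>h\<close> prescribes the values
  of the process at the present time \<open>s\<close> and at the finitely many past times in \<open>T\<close>.
\<close>

definition has_markov_property ::
    "'s set \<Rightarrow> (real \<Rightarrow> 's \<Rightarrow> 's pmf) \<Rightarrow> 'w measure \<Rightarrow> (real \<Rightarrow> 'w \<Rightarrow> 's) \<Rightarrow> bool" where
  "has_markov_property S P M X \<longleftrightarrow>
     (\<forall>s\<ge>0. \<forall>t\<ge>0. \<forall>T h. \<forall>y\<in>S. finite T \<longrightarrow> T \<subseteq> {0..<s} \<longrightarrow> h \<in> insert s T \<rightarrow> S \<longrightarrow>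
        \<P>(w in M. \<forall>u\<in>insert s T. X u w = h u) \<noteq> 0 \<longrightarrow>
        \<P>(w in M. X (s + t) w = y \<bar> \<forall>u\<in>insert s T. X u w = h u) = pmf (P t (h s)) y)"

text \<open>Right-continuous with left limits, with respect to the discrete topology on \<open>S\<close>.\<close>

definition cadlag_path :: "'s set \<Rightarrow> (real \<Rightarrow> 's) \<Rightarrow> bool" where
  "cadlag_path S \<gamma> \<longleftrightarrow>
     (\<forall>t\<ge>0. eventually (\<lambda>u. \<gamma> u = \<gamma> t) (at_right t)) \<and>
     (\<forall>t>0. \<exists>y\<in>S. eventually (\<lambda>u. \<gamma> u = y) (at_left t))"

text \<open>Only times \<open>t \<ge> 0\<close> matter.\<close>

definition markov_process ::
    "'s set \<Rightarrow> (('s \<Rightarrow> real) \<Rightarrow> 's \<Rightarrow> real) \<Rightarrow> 's \<Rightarrow> 'w measure \<Rightarrow> (real \<Rightarrow> 'w \<Rightarrow> 's) \<Rightarrow> bool" where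
  "markov_process S L x0 M X \<longleftrightarrow>
     prob_space M \<and>
     (\<forall>t\<ge>0. X t \<in> measurable M (count_space S)) \<and>
     (\<forall>w\<in>space M. cadlag_path S (\<lambda>t. X t w)) \<and>
     (AE w in M. X 0 w = x0) \<and>
     (\<exists>P. markov_semigroup S P \<and> has_generator S P L \<and> has_markov_property S P M X)"

section \<open>The dual boundary driven symmetric exclusion process\<close>

type_synonym config = "nat \<Rightarrow> nat"

text \<open>
  A configuration on the sites \<open>0, \<dots>, N\<close>; functions on \<^typ>\<open>nat\<close> are made to represent
  configurations uniquely by requiring the value 0 beyond site \<open>N\<close>.
\<close>

definition configs :: "nat \<Rightarrow> config set" where
  "configs N = {\<xi>. (\<forall>x\<in>{1..N-1}. \<xi> x \<in> {0, 1}) \<and> (\<forall>x>N. \<xi> x = 0)}"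

text \<open>
  One particle moved from \<open>x\<close> to \<open>y \<noteq> x\<close>. In the generator below this occurs with coefficient 0
  when \<open>\<xi> x = 0\<close>, so the truncated subtraction is harmless.
\<close>

definition move :: "config \<Rightarrow> nat \<Rightarrow> nat \<Rightarrow> config" where
  "move \<xi> x y = \<xi>(x := \<xi> x - 1, y := \<xi> y + 1)"

definition dual_generator :: "nat \<Rightarrow> real \<Rightarrow> real \<Rightarrow> (config \<Rightarrow> real) \<Rightarrow> config \<Rightarrow> real" where
  "dual_generator N \<omega>L \<omega>R f \<xi> =
     (\<Sum>x = 1..N-2.
        real (\<xi> x) * (1 - real (\<xi> (x+1))) * (f (move \<xi> x (x+1)) - f \<xi>)
      + real (\<xi> (x+1)) * (1 - real (\<xi> x)) * (f (move \<xi> (x+1) x) - f \<xi>))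
     + \<omega>L * real (\<xi> 1) * (f (move \<xi> 1 0) - f \<xi>)
     + \<omega>R * real (\<xi> (N-1)) * (f (move \<xi> (N-1) N) - f \<xi>)"

definition dual_process ::
    "nat \<Rightarrow> real \<Rightarrow> real \<Rightarrow> nat set \<Rightarrow> 'w measure \<Rightarrow> (real \<Rightarrow> 'w \<Rightarrow> config) \<Rightarrow> bool" where
  "dual_process N \<omega>L \<omega>R J M \<xi> \<longleftrightarrow>
     markov_process (configs N) (dual_generator N \<omega>L \<omega>R) (indicator J) M \<xi>"

definition limit_config :: "(real \<Rightarrow> 'w \<Rightarrow> config) \<Rightarrow> 'w \<Rightarrow> config" where
  "limit_config \<xi> w = (\<lambda>x. Lim at_top (\<lambda>t. \<xi> t w x))"

end

theory Submission
  imports Defs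
begin

text \<open>
  Number the particles from left to right and give the \<open>i\<close>-th one, at \<open>y\<close>, the factor
  \<open>(h y - (i-1)) / (h N - (i-1))\<close>. The product \<open>F\<close> of these factors, with \<open>F = 0\<close> as soon as a particle
  sits at 0, is harmonic for the dual generator (\<open>absorb_right_harmonic\<close>). Indeed \<open>h\<close> is harmonic for
  one particle, and the shift by the rank makes the factors of two adjacent particles equal up to their
  denominators, so that the jumps suppressed by exclusion are not missed: each bulk edge contributes a
  discrete gradient (\<open>bulk_prod_exchange\<close>), and the telescoping sum cancels against the absorption
  terms at both ends.

  Consequently the expectation of \<open>F\<close> under the transition law from the initial configuration is
  constant in time. When all \<open>k\<close> particles are absorbed, \<open>F\<close> is the indicator of \<open>\<xi> N = k\<close>. Since \<open>F\<close> is
  bounded on all configurations, the absorption probability equals the initial value of \<open>F\<close> as soon as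
  the probability that a bulk particle is left at time \<open>t\<close> tends to 0. This follows from a bounded
  potential that decreases at rate at least 1 while a bulk particle is left (\<open>potential_drift\<close>,
  \<open>prob_not_absorbed_le\<close>): the probability is \<open>O(1/t)\<close>.

  The process is given by its semigroup and the derivative of that semigroup at time 0. Everything
  about expectations is drawn from one inequality of Dynkin type, \<open>generator_ge_imp_expect_ge\<close>:
  the constancy of the mean of \<open>F\<close>, conservation of the number of particles, invariance of the absorbed configurations and
  the \<open>O(1/t)\<close> bound. To pass to the pathwise limit, \<open>absorbed_path_constant\<close> shows that almost surely
  the path stops moving once it is found absorbed at an integer time, and \<open>measurable_Lim_path\<close> that
  the limit is a random variable.
\<close>

section \<open>Semigroups with a bounded generator\<close>

abbreviation expect_pmf :: "'s pmf \<Rightarrow> ('s \<Rightarrow> real) \<Rightarrow> real" where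
  "expect_pmf \<equiv> measure_pmf.expectation"

lemma integrable_pmf_bounded_on:
  fixes f :: "'s \<Rightarrow> real"
  assumes "set_pmf p \<subseteq> S" and "bounded (f ` S)"
  shows "integrable (measure_pmf p) f"
proof -
  obtain C where "\<And>x. x \<in> S \<Longrightarrow> norm (f x) \<le> C"
    using assms(2) by (auto simp: bounded_iff)
  then show ?thesis
    using assms(1) by (intro measure_pmf.integrable_const_bound[where B = C]) (auto simp: AE_measure_pmf_iff)
qed

lemma bounded_indicator_image: "bounded ((indicator A :: 's \<Rightarrow> real) ` S)"
  by (rule boundedI[where B = 1]) (auto split: split_indicator)

lemma expect_pmf_mono_on:
  assumes "set_pmf p \<subseteq> S" and "bounded (f ` S)" and "bounded (g ` S)"
    and "\<And>x. x \<in> S \<Longrightarrow> f x \<le> g x"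
  shows "expect_pmf p f \<le> expect_pmf p g"
proof (rule integral_mono_AE)
  show "integrable p f" "integrable p g"
    using assms(1-3) by (auto intro: integrable_pmf_bounded_on)
  show "AE x in p. f x \<le> g x"
    using assms(1,4) by (auto simp: AE_measure_pmf_iff)
qed

lemma expect_bind_pmf_bounded_on:
  fixes f :: "'s \<Rightarrow> real"
  assumes p: "set_pmf p \<subseteq> S" and q: "\<And>x. x \<in> S \<Longrightarrow> set_pmf (q x) \<subseteq> S" and f: "bounded (f ` S)"
  shows "expect_pmf (bind_pmf p q) f = expect_pmf p (\<lambda>x. expect_pmf (q x) f)"
proof -
  obtain C where C: "\<And>x. x \<in> S \<Longrightarrow> norm (f x) \<le> C"
    using f by (auto simp: bounded_iff)
  define f' where "f' x = (if x \<in> S then f x else 0)" for x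
  have bound: "norm (f' x) \<le> \<bar>C\<bar>" for x
    using C[of x] by (auto simp: f'_def)
  have eq: "expect_pmf r f = expect_pmf r f'" if "set_pmf r \<subseteq> S" for r
    using that by (intro integral_cong_AE) (auto simp: AE_measure_pmf_iff f'_def)
  have "expect_pmf (bind_pmf p q) f = expect_pmf (bind_pmf p q) f'"
    using p q by (intro eq) auto
  also have "\<dots> = expect_pmf p (\<lambda>x. expect_pmf (q x) f')"
    unfolding measure_pmf_bind
    by (rule integral_bind[where K = "count_space UNIV" and B = "\<bar>C\<bar>" and B' = 1])
       (use bound in \<open>auto simp: measure_pmf.emeasure_space_1 measure_pmf_in_subprob_algebra\<close>)
  also have "\<dots> = expect_pmf p (\<lambda>x. expect_pmf (q x) f)"
    using p q by (intro integral_cong_AE) (auto simp: AE_measure_pmf_iff eq)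
  finally show ?thesis .
qed

lemma abs_expect_pmf_le:
  assumes "set_pmf p \<subseteq> S" and "\<And>x. x \<in> S \<Longrightarrow> \<bar>f x\<bar> \<le> C"
  shows "\<bar>expect_pmf p f\<bar> \<le> C"
proof -
  have f: "bounded (f ` S)"
    using assms(2) by (auto simp: bounded_iff)
  have "expect_pmf p f \<le> expect_pmf p (\<lambda>_. C)"
    using assms(2) by (intro expect_pmf_mono_on[OF assms(1) f]) (auto simp: image_constant_conv dest: abs_le_D1)
  moreover have "expect_pmf p (\<lambda>_. - C) \<le> expect_pmf p f"
    using assms(2) by (intro expect_pmf_mono_on[OF assms(1) _ f])
      (auto simp: image_constant_conv abs_le_iff minus_le_iff)
  ultimately show ?thesis by simp
qed

lemma markov_semigroupD:
  assumes "markov_semigroup S P" and "x \<in> S"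
  shows "t \<ge> 0 \<Longrightarrow> set_pmf (P t x) \<subseteq> S"
    and "P 0 x = return_pmf x"
    and "s \<ge> 0 \<Longrightarrow> t \<ge> 0 \<Longrightarrow> P (s + t) x = bind_pmf (P s x) (P t)"
  using assms unfolding markov_semigroup_def by simp_all

text \<open>
  An integrated form of Dynkin's formula. No differentiability of \<open>t \<mapsto> P t f\<close> is needed: since the
  derivative at time 0 is uniform in the starting point, cutting \<open>[0, t]\<close> into \<open>n\<close> steps of equal
  length makes a total error of at most \<open>t * \<epsilon>\<close>, with \<open>\<epsilon>\<close> arbitrarily small for large \<open>n\<close>.
\<close>

lemma generator_ge_imp_expect_ge:
  assumes P: "markov_semigroup S P" and L: "has_generator S P L"
    and f: "bounded (f ` S)" and g: "bounded (g ` S)"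
    and Lf: "\<And>y. y \<in> S \<Longrightarrow> g y \<le> L f y"
    and x: "x \<in> S" and t: "t \<ge> 0"
    and c: "\<And>r. 0 \<le> r \<Longrightarrow> r \<le> t \<Longrightarrow> c \<le> expect_pmf (P r x) g"
  shows "f x + t * c \<le> expect_pmf (P t x) f"
proof (cases "t = 0")
  case True
  then show ?thesis using markov_semigroupD(2)[OF P x] by simp
next
  case False
  with t have t: "t > 0" by simp
  have sub: "set_pmf (P r y) \<subseteq> S" if "r \<ge> 0" "y \<in> S" for r y
    using markov_semigroupD(1)[OF P that(2,1)] .
  have "f x + t * c \<le> expect_pmf (P t x) f + e" if e: "e > 0" for e
  proof -
    define \<epsilon> where "\<epsilon> = e / t"
    have "\<epsilon> > 0" using e t by (simp add: \<epsilon>_def)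
    have "uniform_limit S (\<lambda>t x. (expect_pmf (P t x) f - f x) / t) (L f) (at_right 0)"
      using L f unfolding has_generator_def by blast
    then have "\<forall>\<^sub>F s in at_right 0. \<forall>y\<in>S. dist ((expect_pmf (P s y) f - f y) / s) (L f y) < \<epsilon>"
      using \<open>\<epsilon> > 0\<close> unfolding uniform_limit_iff by blast
    then obtain \<delta> where \<delta>: "\<delta> > 0"
      "\<And>s y. 0 < s \<Longrightarrow> s < \<delta> \<Longrightarrow> y \<in> S \<Longrightarrow> dist ((expect_pmf (P s y) f - f y) / s) (L f y) < \<epsilon>"
      unfolding eventually_at_right_field by auto
    obtain n :: nat where n: "t / \<delta> < real n" using reals_Archimedean2 by blast
    have "n > 0" using n t \<delta>(1) by (metis divide_pos_pos gr0I less_asym of_nat_0)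
    define s where "s = t / real n"
    have s: "0 < s" "s < \<delta>" "real n * s = t"
      using n t \<delta>(1) \<open>n > 0\<close> by (auto simp: s_def field_simps)
    have step: "f y + s * (g y - \<epsilon>) \<le> expect_pmf (P s y) f" if "y \<in> S" for y
    proof -
      have "g y - \<epsilon> \<le> (expect_pmf (P s y) f - f y) / s"
        using \<delta>(2)[OF s(1,2) that] Lf[OF that] by (auto simp: dist_real_def)
      then show ?thesis using s(1) by (simp add: field_simps)
    qed
    have bounded_P: "bounded ((\<lambda>y. expect_pmf (P s y) f) ` S)"
    proof -
      obtain C where "\<And>x. x \<in> S \<Longrightarrow> \<bar>f x\<bar> \<le> C"
        using f by (auto simp: bounded_iff)
      then have "\<bar>expect_pmf (P s y) f\<bar> \<le> C" if "y \<in> S" for y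
        using that s(1) by (intro abs_expect_pmf_le[OF sub]) auto
      then show ?thesis by (auto simp: bounded_iff)
    qed
    have gen: "f x + real i * s * (c - \<epsilon>) \<le> expect_pmf (P (real i * s) x) f" if "i \<le> n" for i
      using that
    proof (induction i)
      case 0
      then show ?case using markov_semigroupD(2)[OF P x] by simp
    next
      case (Suc i)
      define p where "p = P (real i * s) x"
      have p: "set_pmf p \<subseteq> S" unfolding p_def using s x by (intro sub) auto
      have "real i * s \<le> t"
        using Suc.prems s by (metis Suc_leD mult_right_mono of_nat_mono less_imp_le)
      then have cp: "c \<le> expect_pmf p g" unfolding p_def using s(1) by (intro c) auto
      have i: "integrable p f" "integrable p g"
        by (auto intro: integrable_pmf_bounded_on[OF p] f g)
      have "f x + real (Suc i) * s * (c - \<epsilon>) = (f x + real i * s * (c - \<epsilon>)) + s * (c - \<epsilon>)"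
        by (simp add: algebra_simps)
      also have "\<dots> \<le> expect_pmf p f + s * (expect_pmf p g - \<epsilon>)"
        using Suc.IH Suc.prems cp s(1) unfolding p_def by (intro add_mono mult_left_mono) auto
      also have "\<dots> = expect_pmf p (\<lambda>y. f y + s * (g y - \<epsilon>))"
        using i by simp
      also have "\<dots> \<le> expect_pmf p (\<lambda>y. expect_pmf (P s y) f)"
        using p step i integrable_pmf_bounded_on[OF p bounded_P]
        by (intro integral_mono_AE) (auto simp: AE_measure_pmf_iff)
      also have "\<dots> = expect_pmf (bind_pmf p (P s)) f"
        using sub s(1) by (intro expect_bind_pmf_bounded_on[symmetric, OF p _ f]) auto
      also have "bind_pmf p (P s) = P (real i * s + s) x"
        using markov_semigroupD(3)[OF P x, of "real i * s" s] s(1) by (simp add: p_def)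
      also have "real i * s + s = real (Suc i) * s" by (simp add: algebra_simps)
      finally show ?case .
    qed
    from gen[of n] s(3) have "f x + t * (c - \<epsilon>) \<le> expect_pmf (P t x) f" by simp
    then show ?thesis using t by (simp add: \<epsilon>_def algebra_simps)
  qed
  then show ?thesis by (rule field_le_epsilon)
qed

corollary expect_subharmonic:
  assumes P: "markov_semigroup S P" and L: "has_generator S P L" and f: "bounded (f ` S)"
    and sub: "\<And>y. y \<in> S \<Longrightarrow> 0 \<le> L f y" and x: "x \<in> S" and t: "t \<ge> 0"
  shows "f x \<le> expect_pmf (P t x) f"
proof -
  have "f x + t * 0 \<le> expect_pmf (P t x) f"
    by (rule generator_ge_imp_expect_ge[where g = "\<lambda>_. 0", OF P L f _ sub x t])
       (auto simp: image_constant_conv)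
  then show ?thesis by simp
qed

text \<open>The indicator of a set that no jump leaves is subharmonic, so that set is never left.\<close>

corollary semigroup_stays_in:
  assumes P: "markov_semigroup S P" and L: "has_generator S P L"
    and sub: "\<And>y. y \<in> S \<Longrightarrow> 0 \<le> L (indicator A) y"
    and x: "x \<in> S" "x \<in> A" and t: "t \<ge> 0"
  shows "set_pmf (P t x) \<subseteq> A"
proof -
  have "bounded ((indicator A :: _ \<Rightarrow> real) ` S)"
    by (rule bounded_indicator_image)
  from expect_subharmonic[OF P L this sub x(1) t] x(2)
  have "1 \<le> measure_pmf.prob (P t x) A" by simp
  then have "AE y in P t x. y \<in> A"
    using measure_pmf.prob_le_1[of "P t x" A] by (subst measure_pmf.AE_in_set_eq_1) auto
  then show ?thesis by (auto simp: AE_measure_pmf_iff)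
qed

text \<open>
  The Lyapunov criterion for absorption: \<open>V\<close> cannot lose more than its initial value, and outside the
  absorbing set \<open>B\<close> it is lost at rate at least 1.
\<close>

corollary prob_not_absorbed_le:
  assumes P: "markov_semigroup S P" and L: "has_generator S P L"
    and V: "bounded (V ` S)" "\<And>y. y \<in> S \<Longrightarrow> 0 \<le> V y"
    and drift: "\<And>y. y \<in> S \<Longrightarrow> indicator (- B) y \<le> L (\<lambda>z. - V z) y"
    and B: "\<And>y. y \<in> S \<Longrightarrow> 0 \<le> L (indicator B) y"
    and x: "x \<in> S" and t: "t \<ge> 0"
  shows "t * measure_pmf.prob (P t x) (- B) \<le> V x"
proof -
  have sub: "set_pmf (P r y) \<subseteq> S" if "r \<ge> 0" "y \<in> S" for r y
    using markov_semigroupD(1)[OF P that(2,1)] .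
  have bdd: "bounded ((indicator A :: _ \<Rightarrow> real) ` S)" for A
    by (rule bounded_indicator_image)
  have mono: "measure_pmf.prob (P t x) (- B) \<le> expect_pmf (P r x) (indicator (- B))"
    if r: "0 \<le> r" "r \<le> t" for r
  proof -
    have Prx: "set_pmf (P r x) \<subseteq> S" by (intro sub r x)
    have "measure_pmf.prob (P t x) (- B) = expect_pmf (P (r + (t - r)) x) (indicator (- B))" by simp
    also have "P (r + (t - r)) x = bind_pmf (P r x) (P (t - r))"
      using r by (intro markov_semigroupD(3)[OF P x]) auto
    also have "expect_pmf \<dots> (indicator (- B))
        = expect_pmf (P r x) (\<lambda>y. expect_pmf (P (t - r) y) (indicator (- B)))"
      using r by (intro expect_bind_pmf_bounded_on[OF Prx sub bdd]) auto
    also have "\<dots> \<le> expect_pmf (P r x) (indicator (- B))"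
    proof (rule expect_pmf_mono_on[OF Prx _ bdd])
      show "bounded ((\<lambda>y. expect_pmf (P (t - r) y) (indicator (- B))) ` S)"
        by (intro boundedI[where B = 1]) auto
      show "expect_pmf (P (t - r) y) (indicator (- B)) \<le> indicator (- B) y" if y: "y \<in> S" for y
      proof (cases "y \<in> B")
        case True
        then have "set_pmf (P (t - r) y) \<subseteq> B"
          using r by (intro semigroup_stays_in[OF P L B y]) auto
        then have "measure_pmf.prob (P (t - r) y) (- B) = 0"
          by (auto simp: measure_pmf_zero_iff)
        with True show ?thesis by simp
      qed simp
    qed
    finally show ?thesis .
  qed
  have "bounded ((\<lambda>z. - V z) ` S)"
    using V(1) by (simp add: bounded_iff)
  then have "- V x + t * measure_pmf.prob (P t x) (- B) \<le> expect_pmf (P t x) (\<lambda>z. - V z)"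
    by (rule generator_ge_imp_expect_ge[OF P L _ bdd drift x t mono])
  moreover have "0 \<le> expect_pmf (P t x) V"
    using sub[OF t x] V(2) by (intro integral_nonneg_AE) (auto simp: AE_measure_pmf_iff)
  ultimately show ?thesis by simp
qed

section \<open>Marginals, absorbed states and limits of a Markov process\<close>

lemma event_of_discrete:
  assumes Y: "Y \<in> measurable M (count_space S)"
  shows "{w \<in> space M. Q (Y w)} \<in> sets M"
proof -
  have "{w \<in> space M. Q (Y w)} = Y -` {y \<in> S. Q y} \<inter> space M"
    using measurable_space[OF Y] by auto
  also have "\<dots> \<in> sets M" by (rule measurable_sets[OF Y]) auto
  finally show ?thesis .
qed

text \<open>
  For fixed times the Markov property is used only in this product form, which stays true when the
  condition has probability 0.
\<close>

lemma markov_transition_prob: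
  assumes M: "prob_space M" and X: "\<And>t. t \<ge> 0 \<Longrightarrow> X t \<in> measurable M (count_space S)"
    and mp: "has_markov_property S P M X"
    and st: "s \<ge> 0" "t \<ge> 0" and ab: "a \<in> S" "b \<in> S"
  shows "\<P>(w in M. X s w = a \<and> X (s + t) w = b) = \<P>(w in M. X s w = a) * pmf (P t a) b"
proof -
  interpret prob_space M by (rule M)
  have *: "\<P>(w in M. X s w = a) \<noteq> 0 \<Longrightarrow>
      \<P>(w in M. X (s + t) w = b \<bar> X s w = a) = pmf (P t a) b"
    using mp[unfolded has_markov_property_def, rule_format, of s t b "{}" "\<lambda>_. a"] st ab by simp
  show ?thesis
  proof (cases "\<P>(w in M. X s w = a) = 0")
    case False
    with * show ?thesis by (simp add: cond_prob_def field_simps conj_commute)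
  next
    case True
    have "\<P>(w in M. X s w = a \<and> X (s + t) w = b) \<le> \<P>(w in M. X s w = a)"
    proof (rule finite_measure_mono)
      show "{w \<in> space M. X s w = a} \<in> events" by (rule event_of_discrete[OF X[OF st(1)]])
    qed auto
    with True show ?thesis by (simp add: measure_le_0_iff)
  qed
qed

lemma markov_marginal:
  assumes M: "prob_space M" and X: "\<And>t. t \<ge> 0 \<Longrightarrow> X t \<in> measurable M (count_space S)"
    and mp: "has_markov_property S P M X" and P: "markov_semigroup S P"
    and X0: "AE w in M. X 0 w = x0" and x0: "x0 \<in> S" and S: "countable S" and t: "t \<ge> 0"
  shows "\<P>(w in M. X t w \<in> A) = measure_pmf.prob (P t x0) A"
proof -
  interpret prob_space M by (rule M)
  have Xt: "X t \<in> measurable M (count_space UNIV)"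
    by (rule measurable_compose[OF X[OF t], of "\<lambda>y. y"]) simp
  have ev: "{w \<in> space M. X r w = a} \<in> events" if "r \<ge> 0" for a r
    by (rule event_of_discrete[OF X[OF that]])
  have X0': "\<P>(w in M. X 0 w = x0) = 1"
    using X0 ev[OF order_refl] by (subst prob_Collect_eq_1) auto
  have point: "\<P>(w in M. X t w = y) = pmf (P t x0) y" if y: "y \<in> S" for y
  proof -
    have "\<P>(w in M. X t w = y) = \<P>(w in M. X 0 w = x0 \<and> X (0 + t) w = y)"
    proof (rule finite_measure_eq_AE)
      show "AE w in M. w \<in> {w \<in> space M. X t w = y} \<longleftrightarrow> w \<in> {w \<in> space M. X 0 w = x0 \<and> X (0 + t) w = y}"
        using X0 by eventually_elim auto
      have "{w \<in> space M. X 0 w = x0 \<and> X (0 + t) w = y}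
          = {w \<in> space M. X 0 w = x0} \<inter> {w \<in> space M. X t w = y}" by auto
      then show "{w \<in> space M. X 0 w = x0 \<and> X (0 + t) w = y} \<in> events"
        using ev[OF order_refl] ev[OF t] by simp
    qed (rule ev[OF t])
    also have "\<dots> = pmf (P t x0) y"
      using markov_transition_prob[OF M X mp order_refl t x0 y] X0' by simp
    finally show ?thesis .
  qed
  have "distr M (count_space UNIV) (X t) = measure_pmf (P t x0)"
  proof (rule measure_eqI_countable_AE)
    show "AE y in distr M (count_space UNIV) (X t). y \<in> S"
      using measurable_space[OF X[OF t]] by (subst AE_distr_iff[OF Xt]) auto
    show "AE y in P t x0. y \<in> S"
      using markov_semigroupD(1)[OF P x0 t] by (auto simp: AE_measure_pmf_iff)
    fix y assume "y \<in> S"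
    have "emeasure (distr M (count_space UNIV) (X t)) {y} = emeasure M (X t -` {y} \<inter> space M)"
      by (rule emeasure_distr[OF Xt]) simp
    also have "X t -` {y} \<inter> space M = {w \<in> space M. X t w = y}" by auto
    finally show "emeasure (distr M (count_space UNIV) (X t)) {y} = emeasure (P t x0) {y}"
      using point[OF \<open>y \<in> S\<close>] by (simp add: emeasure_eq_measure emeasure_pmf_single)
  qed (use S in auto)
  moreover have "\<P>(w in M. X t w \<in> A) = measure (distr M (count_space UNIV) (X t)) A"
    by (subst measure_distr[OF Xt]) (auto intro: arg_cong[where f = prob])
  ultimately show ?thesis by simp
qed

lemma right_constant_eqI:
  fixes \<gamma> :: "real \<Rightarrow> 's"
  assumes right: "\<forall>\<^sub>F u in at_right t. \<gamma> u = \<gamma> t"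
    and rat: "\<And>q. q \<in> \<rat> \<Longrightarrow> q \<ge> a \<Longrightarrow> \<gamma> q = y" and t: "t \<ge> a"
  shows "\<gamma> t = y"
proof -
  obtain b where b: "b > t" "\<And>u. t < u \<Longrightarrow> u < b \<Longrightarrow> \<gamma> u = \<gamma> t"
    using right unfolding eventually_at_right_field by auto
  obtain q where "q \<in> \<rat>" "t < q" "q < b" using Rats_dense_in_real[OF b(1)] by auto
  then show ?thesis using b(2)[of q] rat[of q] t by simp
qed

text \<open>
  The transition law keeps an absorbing state in place at each fixed later time, almost surely; the
  exceptional null set is made independent of the time by looking at rational times only, which
  determine a right-continuous path.
\<close>

lemma absorbed_path_constant:
  assumes M: "prob_space M" and X: "\<And>t. t \<ge> 0 \<Longrightarrow> X t \<in> measurable M (count_space S)"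
    and cadlag: "\<And>w. w \<in> space M \<Longrightarrow> cadlag_path S (\<lambda>t. X t w)"
    and mp: "has_markov_property S P M X" and S: "countable S"
    and B: "\<And>b t. b \<in> B \<Longrightarrow> b \<in> S \<Longrightarrow> t \<ge> 0 \<Longrightarrow> set_pmf (P t b) \<subseteq> {b}"
  shows "AE w in M. \<forall>n::nat. X n w \<in> B \<longrightarrow> (\<forall>t\<ge>n. X t w = X n w)"
proof -
  interpret prob_space M by (rule M)
  have ev: "{w \<in> space M. X r w = a} \<in> events" if "r \<ge> 0" for a r
    by (rule event_of_discrete[OF X[OF that]])
  have "AE w in M. X n w = b \<longrightarrow> X q w = b"
    if b: "b \<in> B \<inter> S" and q: "q \<in> \<rat> \<inter> {n..}" for n :: nat and q b
  proof -
    have "set_pmf (P (q - n) b) \<subseteq> {b}" using b q by (intro B) auto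
    then have one: "pmf (P (q - n) b) b = 1"
      using set_pmf_subset_singleton[of "P (q - n) b" b] by simp
    have "\<P>(w in M. X n w = b \<and> X (n + (q - n)) w = b) = \<P>(w in M. X n w = b) * pmf (P (q - n) b) b"
      using b q by (intro markov_transition_prob[OF M X mp]) auto
    then have eq: "\<P>(w in M. X n w = b \<and> X q w = b) = \<P>(w in M. X n w = b)"
      using one by simp
    have "{w \<in> space M. X n w = b \<and> X q w = b} = {w \<in> space M. X n w = b} \<inter> {w \<in> space M. X q w = b}"
      by auto
    then have e: "{w \<in> space M. X n w = b \<and> X q w = b} \<in> events" "{w \<in> space M. X n w = b} \<in> events"
      using ev[of n b] ev[of q b] b q by auto
    define D where "D = {w \<in> space M. X n w = b} - {w \<in> space M. X n w = b \<and> X q w = b}"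
    have "prob D = 0"
      unfolding D_def using eq e by (subst finite_measure_Diff) auto
    moreover have "D \<in> events" unfolding D_def using e by auto
    ultimately have "AE w in M. w \<notin> D" by (subst (asm) prob_eq_0) auto
    with AE_space show ?thesis by eventually_elim (auto simp: D_def)
  qed
  then have "AE w in M. \<forall>n::nat. \<forall>q\<in>\<rat> \<inter> {real n..}. \<forall>b\<in>B \<inter> S. X n w = b \<longrightarrow> X q w = b"
    unfolding AE_all_countable
    by (intro allI AE_ball_countable' countable_Int1[OF countable_rat] countable_Int2[OF S])
  with AE_space show ?thesis
  proof eventually_elim
    case (elim w)
    show ?case
    proof (intro allI impI)
      fix n :: nat and t :: real
      assume n: "X n w \<in> B" and t: "real n \<le> t"
      have "X n w \<in> S" using measurable_space[OF X, of "real n" w] elim(1) by simp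
      show "X t w = X n w"
      proof (rule right_constant_eqI[where \<gamma> = "\<lambda>t. X t w" and a = "real n"])
        show "\<forall>\<^sub>F u in at_right t. X u w = X t w"
          using cadlag[OF elim(1)] t unfolding cadlag_path_def by simp
        show "X q w = X n w" if "q \<in> \<rat>" "q \<ge> real n" for q
          using elim(2)[THEN spec, of n] that n \<open>X n w \<in> S\<close> by blast
      qed (rule t)
    qed
  qed
qed

lemma tendsto_discrete_iff_rational:
  fixes \<phi> :: "'s \<Rightarrow> 'd::discrete_topology"
  assumes right: "\<And>t. t \<ge> 0 \<Longrightarrow> \<forall>\<^sub>F u in at_right t. \<gamma> u = \<gamma> t"
  shows "((\<lambda>t. \<phi> (\<gamma> t)) \<longlongrightarrow> j) at_top \<longleftrightarrow> (\<exists>m::nat. \<forall>q\<in>\<rat> \<inter> {real m..}. \<phi> (\<gamma> q) = j)"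
proof
  assume "((\<lambda>t. \<phi> (\<gamma> t)) \<longlongrightarrow> j) at_top"
  then obtain T where T: "\<And>t. t \<ge> T \<Longrightarrow> \<phi> (\<gamma> t) = j"
    unfolding tendsto_discrete eventually_at_top_linorder by auto
  obtain m :: nat where "T \<le> real m" using real_arch_simple by blast
  with T show "\<exists>m::nat. \<forall>q\<in>\<rat> \<inter> {real m..}. \<phi> (\<gamma> q) = j" by (intro exI[of _ m]) auto
next
  assume "\<exists>m::nat. \<forall>q\<in>\<rat> \<inter> {real m..}. \<phi> (\<gamma> q) = j"
  then obtain m :: nat where m: "\<And>q. q \<in> \<rat> \<Longrightarrow> q \<ge> real m \<Longrightarrow> \<phi> (\<gamma> q) = j" by auto
  have "\<phi> (\<gamma> t) = j" if "t \<ge> real m" for t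
  proof (rule right_constant_eqI[where \<gamma> = "\<lambda>t. \<phi> (\<gamma> t)" and a = "real m"])
    have "\<forall>\<^sub>F u in at_right t. \<gamma> u = \<gamma> t" using that by (intro right) simp
    then show "\<forall>\<^sub>F u in at_right t. \<phi> (\<gamma> u) = \<phi> (\<gamma> t)" by eventually_elim simp
  qed (use m that in auto)
  then show "((\<lambda>t. \<phi> (\<gamma> t)) \<longlongrightarrow> j) at_top"
    unfolding tendsto_discrete eventually_at_top_linorder by auto
qed

text \<open>
  Measurability is needed because \<^term>\<open>Lim\<close> is an unspecified value on paths that do not converge,
  and the measure need not be complete. The choice is the same for all such paths, and the set of
  convergent paths is described by rational times.
\<close>

lemma measurable_Lim_path:
  fixes \<phi> :: "'s \<Rightarrow> nat"
  assumes X: "\<And>t. t \<ge> 0 \<Longrightarrow> X t \<in> measurable M (count_space S)"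
    and cadlag: "\<And>w. w \<in> space M \<Longrightarrow> cadlag_path S (\<lambda>t. X t w)"
  shows "(\<lambda>w. Lim at_top (\<lambda>t. \<phi> (X t w))) \<in> measurable M (count_space UNIV)"
proof -
  define Q where "Q w j \<longleftrightarrow> (\<exists>m::nat. \<forall>q\<in>\<rat> \<inter> {real m..}. \<phi> (X q w) = j)" for w j
  have conv: "((\<lambda>t. \<phi> (X t w)) \<longlongrightarrow> j) at_top \<longleftrightarrow> Q w j" if "w \<in> space M" for w j
    unfolding Q_def using cadlag[OF that]
    by (intro tendsto_discrete_iff_rational) (simp add: cadlag_path_def)
  have 1: "Measurable.pred M (\<lambda>w. Q w j)" for j
  proof -
    have "{w \<in> space M. \<forall>q\<in>\<rat> \<inter> {real m..}. \<phi> (X q w) = j} \<in> sets M" for m :: nat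
    proof (rule sets.sets_Collect_countable_All')
      fix q :: real assume "q \<in> \<rat> \<inter> {real m..}"
      then show "{w \<in> space M. \<phi> (X q w) = j} \<in> sets M"
        by (intro event_of_discrete[OF X]) auto
    next
      show "countable (\<rat> \<inter> {real m..})" by (intro countable_Int1 countable_rat)
    qed
    then show ?thesis unfolding Q_def pred_def by (rule sets.sets_Collect_countable_Ex)
  qed
  have "(\<lambda>w. THE j. Q w j) \<in> measurable M (count_space UNIV)"
  proof (rule measurable_THE[where I = UNIV, OF 1])
    fix w i j assume w: "w \<in> space M" "Q w i" "Q w j"
    show "i = j"
      by (rule tendsto_unique[OF trivial_limit_at_top_linorder conv[OF w(1), THEN iffD2, OF w(2)]
            conv[OF w(1), THEN iffD2, OF w(3)]])
  qed auto
  moreover have "Lim at_top (\<lambda>t. \<phi> (X t w)) = (THE j. Q w j)" if "w \<in> space M" for w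
    using conv[OF that] by (simp add: t2_space_class.Lim_def)
  ultimately show ?thesis
    by (subst measurable_cong[where g = "\<lambda>w. THE j. Q w j"])
qed

section \<open>Functions of a configuration and the dual generator\<close>

lemma configs_bulk: "\<xi> \<in> configs N \<Longrightarrow> y \<in> {1..<N} \<Longrightarrow> \<xi> y = 0 \<or> \<xi> y = 1"
  unfolding configs_def by force

lemma countable_configs: "countable (configs N)"
proof (rule countableI')
  show "inj_on (\<lambda>\<xi>. map \<xi> [0..<Suc N]) (configs N)"
  proof (rule inj_onI)
    fix \<xi> \<zeta> assume *: "\<xi> \<in> configs N" "\<zeta> \<in> configs N" "map \<xi> [0..<Suc N] = map \<zeta> [0..<Suc N]"
    show "\<xi> = \<zeta>"
    proof
      fix y
      show "\<xi> y = \<zeta> y"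
      proof (cases "y < Suc N")
        case True
        then show ?thesis using *(3) by (auto simp: map_eq_conv simp del: upt_Suc)
      next
        case False
        then show ?thesis using *(1,2) unfolding configs_def by simp
      qed
    qed
  qed
qed

text \<open>
  The state space is infinite, but a function of the bulk occupation and of whether the sites 0 and
  \<open>N\<close> are occupied takes only finitely many values.
\<close>

lemma bounded_on_configs:
  fixes f :: "config \<Rightarrow> real"
  assumes "\<And>\<xi>. \<xi> \<in> configs N \<Longrightarrow> f (\<lambda>y. if y \<le> N then min (\<xi> y) 1 else 0) = f \<xi>"
  shows "bounded (f ` configs N)"
proof -
  let ?E = "{\<xi> :: config. \<forall>y. (y \<in> {..N} \<longrightarrow> \<xi> y \<in> {0, 1}) \<and> (y \<notin> {..N} \<longrightarrow> \<xi> y = 0)}"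
  have "f ` configs N \<subseteq> f ` ?E"
  proof
    fix r assume "r \<in> f ` configs N"
    then obtain \<xi> where \<xi>: "\<xi> \<in> configs N" "r = f \<xi>" by blast
    define \<zeta> where "\<zeta> = (\<lambda>y. if y \<le> N then min (\<xi> y) 1 else 0)"
    have "min (\<xi> y) 1 = 0 \<or> min (\<xi> y) 1 = 1" for y by linarith
    then have "\<zeta> \<in> ?E" by (simp add: \<zeta>_def)
    then have "f \<zeta> \<in> f ` ?E" by (rule imageI)
    moreover have "r = f \<zeta>" using assms[OF \<xi>(1)] \<xi>(2) by (simp only: \<zeta>_def)
    ultimately show "r \<in> f ` ?E" by (simp only:)
  qed
  moreover have "finite ?E" by (rule finite_set_of_finite_funs) auto
  ultimately have "finite (f ` configs N)" using finite_subset[OF _ finite_imageI] by blast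
  then show ?thesis by (rule finite_imp_bounded)
qed

text \<open>
  A jump changes a linear statistic of the configuration only through its two end points. With unit
  weights this is the conservation of particles.
\<close>

lemma weighted_sum_move:
  fixes u :: "nat \<Rightarrow> real"
  assumes A: "finite A" and x: "\<xi> x \<ge> 1" and xy: "x \<noteq> y"
  shows "(\<Sum>a\<in>A. real (move \<xi> x y a) * u a)
       = (\<Sum>a\<in>A. real (\<xi> a) * u a) - (if x \<in> A then u x else 0) + (if y \<in> A then u y else 0)"
proof -
  have "(\<Sum>a\<in>A. real (move \<xi> x y a) * u a)
      = (\<Sum>a\<in>A. real (\<xi> a) * u a - (if a = x then u a else 0) + (if a = y then u a else 0))"
    using x xy by (intro sum.cong) (auto simp: move_def of_nat_diff algebra_simps)
  then show ?thesis using A by (simp add: sum.distrib sum_subtractf)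
qed

lemma sum_move:
  assumes "finite A" and "\<xi> x \<ge> 1" and "x \<noteq> y"
  shows "sum (move \<xi> x y) A + of_bool (x \<in> A) = sum \<xi> A + of_bool (y \<in> A)"
proof -
  have "real (sum (move \<xi> x y) A + of_bool (x \<in> A)) = real (sum \<xi> A + of_bool (y \<in> A))"
    using weighted_sum_move[of A \<xi> x y "\<lambda>_. 1"] assms by simp
  then show ?thesis by (simp only: of_nat_eq_iff)
qed

lemma dual_generator_uminus: "dual_generator N \<omega>L \<omega>R (\<lambda>\<zeta>. - f \<zeta>) \<xi> = - dual_generator N \<omega>L \<omega>R f \<xi>"
proof -
  have *: "- f a - - f b = - (f a - f b)" for a b by simp
  show ?thesis
    unfolding dual_generator_def * mult_minus_right
    by (simp only: minus_add_distrib sum_negf sum.distrib)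
qed

text \<open>
  The generator of an indicator can be negative only at a configuration of the set, through a jump that
  leaves the set. The condition below forbids every move of a bulk particle out of \<open>A\<close>, not just
  those to a neighbouring site; for the sets of interest here (a fixed total number of particles, or
  absorbed configurations, which have no bulk particle) this costs nothing.
\<close>

lemma dual_generator_indicator_nonneg:
  assumes N: "N \<ge> 2" and \<omega>: "\<omega>L \<ge> 0" "\<omega>R \<ge> 0" and \<xi>: "\<xi> \<in> configs N"
    and closed: "\<And>x y. \<xi> \<in> A \<Longrightarrow> x \<in> {1..<N} \<Longrightarrow> \<xi> x \<ge> 1 \<Longrightarrow> y \<le> N \<Longrightarrow> y \<noteq> x \<Longrightarrow> move \<xi> x y \<in> A"
  shows "0 \<le> dual_generator N \<omega>L \<omega>R (indicator A) \<xi>"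
proof -
  have jump: "0 \<le> c * real (\<xi> x) * (indicator A (move \<xi> x y) - indicator A \<xi>)"
    if "c \<ge> 0" "x \<in> {1..<N}" "y \<le> N" "y \<noteq> x" for c :: real and x y
  proof (cases "\<xi> x = 0")
    case False
    then have "indicator A \<xi> \<le> (indicator A (move \<xi> x y) :: real)"
      using closed[of x y] that by (auto simp: indicator_def)
    then show ?thesis using that by simp
  qed simp
  have "real (\<xi> y) \<le> 1" if "y \<in> {1..<N}" for y
    using configs_bulk[OF \<xi> that] by auto
  then have "0 \<le> real (\<xi> x) * (1 - real (\<xi> (x+1))) * (indicator A (move \<xi> x (x+1)) - indicator A \<xi>)
      + real (\<xi> (x+1)) * (1 - real (\<xi> x)) * (indicator A (move \<xi> (x+1) x) - indicator A \<xi>)"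
    if "x \<in> {1..N-2}" for x
    using jump[of "1 - real (\<xi> (x+1))" x "x+1"] jump[of "1 - real (\<xi> x)" "x+1" x] that
    by (auto simp: mult_ac)
  moreover have "0 \<le> \<omega>L * real (\<xi> 1) * (indicator A (move \<xi> 1 0) - indicator A \<xi>)"
    "0 \<le> \<omega>R * real (\<xi> (N-1)) * (indicator A (move \<xi> (N-1) N) - indicator A \<xi>)"
    using N \<omega> by (intro jump; simp)+
  ultimately show ?thesis
    unfolding dual_generator_def by (intro add_nonneg_nonneg[OF add_nonneg_nonneg] sum_nonneg)
qed

section \<open>The harmonic function\<close>

definition below :: "config \<Rightarrow> nat \<Rightarrow> nat" where
  "below \<xi> y = sum \<xi> {1..<y}"

definition site_factor :: "(nat \<Rightarrow> real) \<Rightarrow> config \<Rightarrow> nat \<Rightarrow> real" where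
  "site_factor h \<xi> y = (h y - real (below \<xi> y)) ^ \<xi> y"

definition bulk_prod :: "nat \<Rightarrow> (nat \<Rightarrow> real) \<Rightarrow> config \<Rightarrow> real" where
  "bulk_prod N h \<xi> = (\<Prod>y\<in>{1..<N}. site_factor h \<xi> y)"

text \<open>
  When \<open>x\<close> is occupied, this is the product over the other bulk particles, with the particle at \<open>x\<close>
  still counted among those below them. It is the amount by which \<open>bulk_prod\<close> grows when the particle
  at \<open>x\<close> jumps to an empty right neighbour and \<open>h (x+1) = h x + 1\<close>: a flux through the edge.
\<close>

definition bulk_prod_without :: "nat \<Rightarrow> (nat \<Rightarrow> real) \<Rightarrow> config \<Rightarrow> nat \<Rightarrow> real" where
  "bulk_prod_without N h \<xi> x = real (\<xi> x) * (\<Prod>y\<in>{1..<N} - {x}. site_factor h \<xi> y)"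

text \<open>
  The product of the theorem, extended to all configurations: a particle at \<open>N\<close> would contribute a
  quotient with equal numerator and denominator and is left out, and a particle at 0 would contribute
  \<open>h 0 = 0\<close>. The denominator then depends on the number of bulk particles alone, so that an exchange
  inside the bulk only changes the numerator.
\<close>

definition absorb_right :: "nat \<Rightarrow> (nat \<Rightarrow> real) \<Rightarrow> config \<Rightarrow> real" where
  "absorb_right N h \<xi> =
     (if \<xi> 0 = 0 then bulk_prod N h \<xi> / (\<Prod>i<below \<xi> N. h N - real i) else 0)"

lemma bulk_prod_remove:
  assumes "x \<in> {1..<N}" and "\<xi> x = 1"
  shows "bulk_prod N h \<xi> = (h x - real (below \<xi> x)) * bulk_prod_without N h \<xi> x"
proof -
  have "bulk_prod N h \<xi> = site_factor h \<xi> x * (\<Prod>y\<in>{1..<N} - {x}. site_factor h \<xi> y)"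
    unfolding bulk_prod_def using assms(1) by (intro prod.remove) auto
  then show ?thesis using assms(2) by (simp add: bulk_prod_without_def site_factor_def)
qed

text \<open>
  The generator of one bulk edge acts on the product as a discrete gradient. For a single particle this
  is \<open>h (x+1) - h x = 1\<close>. The point is the case of two adjacent particles: no jump happens, and the
  right-hand side vanishes because the factors \<open>h x - c\<close> and \<open>h (x+1) - (c+1)\<close> agree, where \<open>c\<close> is
  the number of particles below \<open>x\<close>. This is why the rank of a particle is subtracted from \<open>h\<close>.
\<close>

lemma bulk_prod_exchange:
  assumes \<xi>: "\<xi> \<in> configs N" and x: "x \<ge> 1" "x + 1 < N" and h: "h (x+1) = h x + 1"
  shows "real (\<xi> x) * (1 - real (\<xi> (x+1))) * (bulk_prod N h (move \<xi> x (x+1)) - bulk_prod N h \<xi>)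
       + real (\<xi> (x+1)) * (1 - real (\<xi> x)) * (bulk_prod N h (move \<xi> (x+1) x) - bulk_prod N h \<xi>)
       = bulk_prod_without N h \<xi> x - bulk_prod_without N h \<xi> (x+1)"
proof -
  define R where "R = {1..<N} - {x, x+1}"
  define W where "W = (\<Prod>y\<in>R. site_factor h \<xi> y)"
  (* Only the factors at x and x+1 differ between the configurations involved; written with a,
     they are explicit functions of the two occupation numbers. *)
  define a where "a = h x - real (below \<xi> x)"
  have sets: "{1..<N} = insert x (insert (x+1) R)" "{1..<N} - {x} = insert (x+1) R"
    "{1..<N} - {x+1} = insert x R" and R: "finite R" "x \<notin> R" "x + 1 \<notin> R"
    using x by (auto simp: R_def)
  have below_Suc: "below \<zeta> (x+1) = below \<zeta> x + \<zeta> x" for \<zeta>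
    using x(1) by (simp add: below_def)
  have prod: "bulk_prod N h \<zeta> = a ^ \<zeta> x * (a + 1 - real (\<zeta> x)) ^ \<zeta> (x+1) * W"
    if "below \<zeta> x = below \<xi> x" "\<And>y. y \<in> R \<Longrightarrow> \<zeta> y = \<xi> y" "\<And>y. y \<in> R \<Longrightarrow> below \<zeta> y = below \<xi> y" for \<zeta>
  proof -
    have "(\<Prod>y\<in>R. site_factor h \<zeta> y) = W"
      unfolding W_def using that(2,3) by (intro prod.cong) (auto simp: site_factor_def)
    moreover have "site_factor h \<zeta> x = a ^ \<zeta> x" "site_factor h \<zeta> (x+1) = (a + 1 - real (\<zeta> x)) ^ \<zeta> (x+1)"
      unfolding site_factor_def below_Suc using that(1) h by (auto simp: a_def algebra_simps)
    ultimately show ?thesis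
      unfolding bulk_prod_def sets(1) using R by simp
  qed
  have moved: "bulk_prod N h (move \<xi> p q) = a ^ (move \<xi> p q) x * (a + 1 - real ((move \<xi> p q) x)) ^ (move \<xi> p q) (x+1) * W"
    if pq: "{p, q} = {x, x+1}" "p \<noteq> q" "\<xi> p = 1" for p q
  proof (rule prod)
    show "below (move \<xi> p q) x = below \<xi> x"
      unfolding below_def using sum_move[of "{1..<x}" \<xi> p q] pq by (auto simp: doubleton_eq_iff)
    fix y assume y: "y \<in> R"
    show "move \<xi> p q y = \<xi> y"
      using y pq by (auto simp: R_def move_def)
    have "p \<in> {1..<y} \<longleftrightarrow> q \<in> {1..<y}"
      using y pq(1) x(1) by (auto simp: R_def doubleton_eq_iff)
    then show "below (move \<xi> p q) y = below \<xi> y"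
      unfolding below_def using sum_move[of "{1..<y}" \<xi> p q] pq by auto
  qed
  have gaps: "bulk_prod_without N h \<xi> x = real (\<xi> x) * ((a + 1 - real (\<xi> x)) ^ \<xi> (x+1) * W)"
    "bulk_prod_without N h \<xi> (x+1) = real (\<xi> (x+1)) * (a ^ \<xi> x * W)"
    unfolding bulk_prod_without_def sets(2,3) W_def using R h
    by (simp_all add: site_factor_def below_Suc[simplified] a_def algebra_simps)
  have "\<xi> x = 0 \<or> \<xi> x = 1" "\<xi> (x+1) = 0 \<or> \<xi> (x+1) = 1"
    using configs_bulk[OF \<xi>] x by auto
  then consider "\<xi> x = \<xi> (x+1)" | "\<xi> x = 1" "\<xi> (x+1) = 0" | "\<xi> x = 0" "\<xi> (x+1) = 1" by auto
  then show ?thesis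
  proof cases
    case 1
    with \<open>\<xi> x = 0 \<or> \<xi> x = 1\<close> show ?thesis unfolding gaps by auto
  next
    case 2
    then show ?thesis
      unfolding gaps using prod[of \<xi>] moved[of x "x+1"] by (simp add: move_def algebra_simps)
  next
    case 3
    then show ?thesis
      unfolding gaps using prod[of \<xi>] moved[of "x+1" x] by (simp add: move_def algebra_simps insert_commute)
  qed
qed

text \<open>
  The bulk contributions telescope to the flux at site 1 minus the flux at site \<open>N-1\<close>. The values of
  \<open>h\<close> at the ends are chosen to cancel them: \<open>\<omega>L * h 1 = 1\<close> makes the loss at 0 equal to the first,
  and \<open>\<omega>R * (h N - h (N-1)) = 1\<close> makes the gain at \<open>N\<close> equal to the second.
\<close>

lemma absorb_right_harmonic:
  assumes N: "N \<ge> 2" and \<omega>: "\<omega>L > 0" "\<omega>R > 0"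
    and h: "\<And>y. y \<in> {1..N-1} \<Longrightarrow> h y = 1 / \<omega>L + real y - 1"
    and hN: "h N = 1 / \<omega>L + 1 / \<omega>R + real N - 2"
    and \<xi>: "\<xi> \<in> configs N"
  shows "dual_generator N \<omega>L \<omega>R (absorb_right N h) \<xi> = 0"
proof (cases "\<xi> 0 = 0")
  case False
  then have "absorb_right N h \<xi> = 0" by (simp add: absorb_right_def)
  moreover have "absorb_right N h (move \<xi> x y) = 0" if "x \<ge> 1" for x y
    using that False by (auto simp: absorb_right_def move_def)
  ultimately show ?thesis
    using N by (simp add: dual_generator_def)
next
  case True
  define D where "D = (\<Prod>i<below \<xi> N. h N - real i)"
  let ?F = "absorb_right N h" and ?G = "bulk_prod_without N h \<xi>"
  have F: "?F \<xi> = bulk_prod N h \<xi> / D"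
    using True by (simp add: absorb_right_def D_def)
  have bulk_move: "?F (move \<xi> p q) = bulk_prod N h (move \<xi> p q) / D"
    if "p \<in> {1..<N}" "q \<in> {1..<N}" "p \<noteq> q" "\<xi> p = 1" for p q
  proof -
    have "below (move \<xi> p q) N = below \<xi> N"
      unfolding below_def using sum_move[of "{1..<N}" \<xi> p q] that by simp
    moreover have "move \<xi> p q 0 = 0" using that True by (simp add: move_def)
    ultimately show ?thesis by (simp add: absorb_right_def D_def)
  qed
  have edge: "real (\<xi> x) * (1 - real (\<xi> (x+1))) * (?F (move \<xi> x (x+1)) - ?F \<xi>)
      + real (\<xi> (x+1)) * (1 - real (\<xi> x)) * (?F (move \<xi> (x+1) x) - ?F \<xi>)
      = (?G x - ?G (x+1)) / D" if x: "x \<in> {1..N-2}" for x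
  proof -
    have x': "x \<in> {1..<N}" "x+1 \<in> {1..<N}" using x by auto
    have occ: "\<xi> x = 0 \<or> \<xi> x = 1" "\<xi> (x+1) = 0 \<or> \<xi> (x+1) = 1"
      using configs_bulk[OF \<xi>] x' by blast+
    have "h (x+1) = h x + 1" using h[of x] h[of "x+1"] x by auto
    moreover have "x \<ge> 1" "x + 1 < N" using x by auto
    ultimately have "(?G x - ?G (x+1)) / D = (real (\<xi> x) * (1 - real (\<xi> (x+1))) * (bulk_prod N h (move \<xi> x (x+1)) - bulk_prod N h \<xi>)
       + real (\<xi> (x+1)) * (1 - real (\<xi> x)) * (bulk_prod N h (move \<xi> (x+1) x) - bulk_prod N h \<xi>)) / D"
      by (simp only: bulk_prod_exchange[OF \<xi>])
    also have "\<dots> = real (\<xi> x) * (1 - real (\<xi> (x+1))) * (?F (move \<xi> x (x+1)) - ?F \<xi>)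
      + real (\<xi> (x+1)) * (1 - real (\<xi> x)) * (?F (move \<xi> (x+1) x) - ?F \<xi>)"
      using occ bulk_move[OF x'] bulk_move[OF x'(2,1)] F
      by (elim disjE) (simp_all add: diff_divide_distrib)
    finally show ?thesis ..
  qed
  have "(\<Sum>x = 1..N-2. real (\<xi> x) * (1 - real (\<xi> (x+1))) * (?F (move \<xi> x (x+1)) - ?F \<xi>)
      + real (\<xi> (x+1)) * (1 - real (\<xi> x)) * (?F (move \<xi> (x+1) x) - ?F \<xi>))
      = (?G 1 - ?G (N-1)) / D"
  proof -
    have "(\<Sum>x = 1..N-2. ?G (Suc x) - ?G x) = ?G (Suc (N-2)) - ?G 1"
      by (rule sum_Suc_diff) simp
    moreover have "Suc (N-2) = N-1" using N by simp
    ultimately have "(\<Sum>x = 1..N-2. ?G x - ?G (x+1)) = ?G 1 - ?G (N-1)"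
      by (simp add: sum_subtractf)
    then have "(\<Sum>x = 1..N-2. (?G x - ?G (x+1)) / D) = (?G 1 - ?G (N-1)) / D"
      by (simp only: sum_divide_distrib[symmetric])
    with sum.cong[OF refl edge] show ?thesis by (rule trans)
  qed
  moreover have "\<omega>L * real (\<xi> 1) * (?F (move \<xi> 1 0) - ?F \<xi>) = - ?G 1 / D"
  proof (cases "\<xi> 1 = 0")
    case True
    then show ?thesis by (simp add: bulk_prod_without_def)
  next
    case False
    then have 1: "\<xi> 1 = 1" using configs_bulk[OF \<xi>, of 1] N by auto
    have "?F (move \<xi> 1 0) = 0" by (simp add: absorb_right_def move_def)
    moreover have "bulk_prod N h \<xi> = 1 / \<omega>L * ?G 1"
      using bulk_prod_remove[of 1 N \<xi> h] 1 N h[of 1] by (simp add: below_def)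
    ultimately show ?thesis using 1 F \<omega> by simp
  qed
  moreover have "\<omega>R * real (\<xi> (N-1)) * (?F (move \<xi> (N-1) N) - ?F \<xi>) = ?G (N-1) / D"
  proof (cases "\<xi> (N-1) = 0")
    case True
    then show ?thesis by (simp add: bulk_prod_without_def)
  next
    case False
    then have 1: "\<xi> (N-1) = 1" using configs_bulk[OF \<xi>, of "N-1"] N by auto
    define j where "j = below \<xi> (N-1)"
    define D' where "D' = (\<Prod>i<j. h N - real i)"
    let ?\<zeta> = "move \<xi> (N-1) N"
    have split: "{1..<N} = insert (N-1) {1..<N-1}" "{1..<N} - {N-1} = {1..<N-1}" using N by auto
    have "below \<xi> N = Suc j"
      unfolding j_def below_def using 1 by (subst split(1)) simp
    then have D: "D = D' * (h N - real j)" by (simp add: D_def D'_def)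
    have same: "?\<zeta> y = \<xi> y" if "y < N-1" for y using that by (simp add: move_def)
    then have same_below: "below ?\<zeta> y = below \<xi> y" if "y \<le> N-1" for y
      using that unfolding below_def by (intro sum.cong) auto
    have \<zeta>: "?\<zeta> (N-1) = 0" using 1 N by (simp add: move_def)
    have "below ?\<zeta> N = j"
      using \<zeta> same_below[of "N-1"] unfolding below_def j_def by (subst split(1)) simp
    moreover have "?\<zeta> 0 = 0" using same[of 0] N \<open>\<xi> 0 = 0\<close> by simp
    moreover have "bulk_prod N h ?\<zeta> = ?G (N-1)"
    proof -
      have "bulk_prod N h ?\<zeta> = site_factor h ?\<zeta> (N-1) * (\<Prod>y\<in>{1..<N-1}. site_factor h ?\<zeta> y)"
        unfolding bulk_prod_def by (subst split(1)) simp
      also have "(\<Prod>y\<in>{1..<N-1}. site_factor h ?\<zeta> y) = (\<Prod>y\<in>{1..<N-1}. site_factor h \<xi> y)"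
      proof (rule prod.cong)
        fix y assume "y \<in> {1..<N-1}"
        then have "y < N-1" "y \<le> N-1" by auto
        then show "site_factor h ?\<zeta> y = site_factor h \<xi> y"
          by (simp only: site_factor_def same same_below)
      qed simp
      finally show ?thesis
        using \<zeta> 1 split(2) by (simp add: bulk_prod_without_def site_factor_def)
    qed
    ultimately have F\<zeta>: "?F ?\<zeta> = ?G (N-1) / D'" by (simp add: absorb_right_def D'_def)
    have F\<xi>: "?F \<xi> = (h (N-1) - real j) * ?G (N-1) / D"
      using F bulk_prod_remove[of "N-1" N \<xi> h] 1 N by (simp add: j_def)
    (* At most N-2 particles lie below N-1, while h N > N-2: the denominators do not vanish. *)
    have "j \<le> (\<Sum>y\<in>{1..<N-1}. 1)"
      unfolding j_def below_def
    proof (rule sum_mono)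
      fix y assume "y \<in> {1..<N-1}"
      then have "y \<in> {1..<N}" by auto
      from configs_bulk[OF \<xi> this] show "\<xi> y \<le> 1" by auto
    qed
    then have "real j \<le> real N - 2" using N by (simp add: of_nat_diff)
    moreover have "h N > real N - 2" using hN \<omega> by (simp add: add_pos_pos)
    ultimately have pos: "h N - real j > 0" by simp
    have diff: "h N = h (N-1) + 1 / \<omega>R" using h[of "N-1"] hN N by (simp add: of_nat_diff)
    have "?F ?\<zeta> = (h N - real j) * ?G (N-1) / D"
      unfolding F\<zeta> D using pos by simp
    then have "?F ?\<zeta> - ?F \<xi> = ((h N - real j) - (h (N-1) - real j)) * ?G (N-1) / D"
      unfolding F\<xi> by (simp only: diff_divide_distrib left_diff_distrib)
    then show ?thesis using 1 \<omega> diff by simp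
  qed
  ultimately show ?thesis
    unfolding dual_generator_def by (simp only: diff_divide_distrib)
qed

lemma bounded_absorb_right: "bounded (absorb_right N h ` configs N)"
proof (rule bounded_on_configs)
  fix \<xi> assume \<xi>: "\<xi> \<in> configs N"
  let ?\<zeta> = "\<lambda>y. if y \<le> N then min (\<xi> y) 1 else 0"
  have same: "?\<zeta> y = \<xi> y" if "y \<in> {1..<N}" for y
    using configs_bulk[OF \<xi> that] that by auto
  have same_below: "below ?\<zeta> y = below \<xi> y" if "y \<le> N" for y
    unfolding below_def using that by (intro sum.cong same) auto
  have "bulk_prod N h ?\<zeta> = bulk_prod N h \<xi>"
    unfolding bulk_prod_def site_factor_def
  proof (rule prod.cong)
    fix y assume y: "y \<in> {1..<N}"
    then have "below ?\<zeta> y = below \<xi> y" by (intro same_below) auto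
    then show "(h y - real (below ?\<zeta> y)) ^ ?\<zeta> y = (h y - real (below \<xi> y)) ^ \<xi> y"
      by (simp only: same[OF y])
  qed simp
  moreover have "?\<zeta> 0 = 0 \<longleftrightarrow> \<xi> 0 = 0" by auto
  ultimately show "absorb_right N h ?\<zeta> = absorb_right N h \<xi>"
    by (simp only: absorb_right_def same_below order_refl)
qed

definition absorbed :: "nat \<Rightarrow> config set" where
  "absorbed N = {\<xi>. \<forall>y\<in>{1..<N}. \<xi> y = 0}"

lemma absorb_right_absorbed:
  assumes "\<xi> \<in> absorbed N" and "sum \<xi> {0..N} = k" and N: "N \<ge> 1"
  shows "absorb_right N h \<xi> = of_bool (\<xi> N = k)"
proof -
  have zero: "\<xi> y = 0" if "y \<in> {1..<N}" for y
    using assms(1) that unfolding absorbed_def by blast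
  then have "bulk_prod N h \<xi> = 1" "below \<xi> N = 0"
    by (simp_all add: bulk_prod_def site_factor_def below_def)
  moreover have "sum \<xi> {0..N} = \<xi> 0 + \<xi> N"
  proof -
    have "{0..N} = insert 0 (insert N {1..<N})" using N by auto
    then show ?thesis using N zero by simp
  qed
  ultimately show ?thesis using assms(2) by (auto simp: absorb_right_def)
qed

text \<open>
  In increasing order, the \<open>i\<close>-th particle has exactly \<open>i - 1\<close> particles below it.
\<close>

lemma absorb_right_initial:
  assumes x: "strict_mono_on {1..k} x" and sub: "x ` {1..k} \<subseteq> {1..<N}"
  shows "absorb_right N h (indicator (x ` {1..k}))
       = (\<Prod>i = 1..k. (h (x i) - (real i - 1)) / (h N - (real i - 1)))"
proof -
  let ?J = "x ` {1..k}"
  have inj: "inj_on x {1..k}" using x by (rule strict_mono_on_imp_inj_on)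
  have count: "below (indicator ?J) y = card (?J \<inter> {1..<y})" for y
    unfolding below_def using sum_indicator_eq_card[of "{1..<y}" ?J] by (simp add: Int_commute)
  have below_x: "below (indicator ?J) (x i) = i - 1" if i: "i \<in> {1..k}" for i
  proof -
    have "?J \<inter> {1..<x i} = x ` {1..<i}"
    proof
      show "?J \<inter> {1..<x i} \<subseteq> x ` {1..<i}"
        using strict_mono_on_less[OF x _ i] by auto
      show "x ` {1..<i} \<subseteq> ?J \<inter> {1..<x i}"
        using strict_mono_onD[OF x _ i] i sub by fastforce
    qed
    moreover have "card (x ` {1..<i}) = i - 1"
      using i by (subst card_image[OF inj_on_subset[OF inj]]) auto
    ultimately show ?thesis by (simp only: count)
  qed
  have "bulk_prod N h (indicator ?J) = (\<Prod>y\<in>?J. h y - real (below (indicator ?J) y))"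
    unfolding bulk_prod_def
  proof (rule prod.mono_neutral_cong_right)
    show "\<forall>y\<in>{1..<N} - ?J. site_factor h (indicator ?J) y = 1"
      by (simp add: site_factor_def)
    fix y assume "y \<in> ?J"
    then show "site_factor h (indicator ?J) y = h y - real (below (indicator ?J) y)"
      by (simp add: site_factor_def)
  qed (use sub in auto)
  also have "\<dots> = (\<Prod>i = 1..k. h (x i) - (real i - 1))"
    unfolding prod.reindex[OF inj] comp_def
  proof (rule prod.cong)
    fix i assume i: "i \<in> {1..k}"
    then show "h (x i) - real (below (indicator ?J) (x i)) = h (x i) - (real i - 1)"
      unfolding below_x[OF i] by (simp add: of_nat_diff)
  qed simp
  finally have num: "bulk_prod N h (indicator ?J) = (\<Prod>i = 1..k. h (x i) - (real i - 1))" .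
  have "below (indicator ?J) N = k"
  proof -
    have "?J \<inter> {1..<N} = ?J" using sub by auto
    then show ?thesis by (simp only: count card_image[OF inj]) simp
  qed
  moreover have "(\<Prod>i<k. h N - real i) = (\<Prod>i = 1..k. h N - (real i - 1))"
    by (rule prod.reindex_bij_witness[of _ "\<lambda>i. i - 1" Suc]) auto
  moreover have "indicator ?J 0 = (0::nat)"
  proof -
    have "0 \<notin> ?J" using sub by (meson atLeastLessThan_iff not_one_le_zero subsetD)
    then show ?thesis by (rule indicator_simps)
  qed
  ultimately show ?thesis
    unfolding absorb_right_def num prod_dividef by simp
qed

section \<open>A potential for the number of bulk particles\<close>

text \<open>
  For one particle, \<open>y * (N - y)\<close> solves the discrete Poisson equation with right-hand side \<open>-2\<close>. The
  added constant compensates its slope \<open>N - 1\<close> at both ends: absorption from site 1 or \<open>N-1\<close> lowers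
  the potential at rate at least \<open>N\<close>.
\<close>

definition site_potential :: "nat \<Rightarrow> real \<Rightarrow> real \<Rightarrow> nat \<Rightarrow> real" where
  "site_potential N \<omega>L \<omega>R y = real N / \<omega>L + real N / \<omega>R + real y * (real N - real y)"

definition potential :: "nat \<Rightarrow> real \<Rightarrow> real \<Rightarrow> config \<Rightarrow> real" where
  "potential N \<omega>L \<omega>R \<xi> = (\<Sum>y\<in>{1..<N}. real (\<xi> y) * site_potential N \<omega>L \<omega>R y)"

lemma sum_by_parts_linear:
  fixes a :: "nat \<Rightarrow> real" and N :: real
  shows "(\<Sum>x = 1..n. (a x - a (x+1)) * (N - 1 - 2 * real x))
       = (N - 1) * a 1 - 2 * (\<Sum>x = 1..n. a x) - (N - 1 - 2 * real n) * a (n+1)"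
  by (induction n) (simp_all add: algebra_simps)

text \<open>
  Exclusion does not affect linear statistics: on an edge with two particles the two jumps that are
  suppressed would have cancelled. So the drift of the potential is that of independent particles, at
  most \<open>-1\<close> per bulk particle.
\<close>

lemma potential_drift:
  assumes N: "N \<ge> 2" and \<omega>: "\<omega>L > 0" "\<omega>R > 0" and \<xi>: "\<xi> \<in> configs N"
  shows "indicator (- absorbed N) \<xi> \<le> dual_generator N \<omega>L \<omega>R (\<lambda>\<zeta>. - potential N \<omega>L \<omega>R \<zeta>) \<xi>"
proof -
  let ?V = "potential N \<omega>L \<omega>R" and ?u = "site_potential N \<omega>L \<omega>R"
  define \<eta> where "\<eta> y = real (\<xi> y)" for y
  have occ: "\<xi> y = 0 \<or> \<xi> y = 1" if "y \<in> {1..<N}" for y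
    by (rule configs_bulk[OF \<xi> that])
  have change: "?V (move \<xi> p q) - ?V \<xi> = (if q \<in> {1..<N} then ?u q else 0) - ?u p"
    if "p \<in> {1..<N}" "p \<noteq> q" "\<xi> p = 1" for p q
    unfolding potential_def using weighted_sum_move[of "{1..<N}" \<xi> p q ?u] that by simp
  have u_Suc: "?u (x+1) - ?u x = real N - 1 - 2 * real x" for x
    by (simp add: site_potential_def algebra_simps)
  have edge: "real (\<xi> x) * (1 - real (\<xi> (x+1))) * (?V (move \<xi> x (x+1)) - ?V \<xi>)
      + real (\<xi> (x+1)) * (1 - real (\<xi> x)) * (?V (move \<xi> (x+1) x) - ?V \<xi>)
      = (\<eta> x - \<eta> (x+1)) * (real N - 1 - 2 * real x)" if x: "x \<in> {1..N-2}" for x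
  proof -
    have x': "x \<in> {1..<N}" "x+1 \<in> {1..<N}" using x by auto
    show ?thesis
      using occ[OF x'(1)] occ[OF x'(2)] change[of x "x+1"] change[of "x+1" x] x' u_Suc[of x]
      by (elim disjE) (simp_all add: \<eta>_def)
  qed
  have "(\<Sum>x = 1..N-2. real (\<xi> x) * (1 - real (\<xi> (x+1))) * (?V (move \<xi> x (x+1)) - ?V \<xi>)
      + real (\<xi> (x+1)) * (1 - real (\<xi> x)) * (?V (move \<xi> (x+1) x) - ?V \<xi>))
    = (real N - 1) * \<eta> 1 - 2 * (\<Sum>x = 1..N-2. \<eta> x) - (real N - 1 - 2 * real (N-2)) * \<eta> (N-2+1)"
    by (rule trans[OF sum.cong[OF refl edge] sum_by_parts_linear])
  also have "\<dots> = (real N - 1) * (\<eta> 1 + \<eta> (N-1)) - 2 * (\<Sum>x\<in>{1..<N}. \<eta> x)"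
  proof -
    have 1: "N - 2 + 1 = N - 1" and 2: "{1..<N} = insert (N-1) {1..N-2}" and 3: "N - 1 \<notin> {1..N-2}"
      using N by auto
    have "(\<Sum>x\<in>{1..<N}. \<eta> x) = \<eta> (N-1) + (\<Sum>x = 1..N-2. \<eta> x)"
      unfolding 2 using 3 by (subst sum.insert) auto
    moreover have "real (N-2) = real N - 2" using N by simp
    ultimately show ?thesis unfolding 1 by (simp add: algebra_simps)
  qed
  finally have bulk: "(\<Sum>x = 1..N-2. real (\<xi> x) * (1 - real (\<xi> (x+1))) * (?V (move \<xi> x (x+1)) - ?V \<xi>)
      + real (\<xi> (x+1)) * (1 - real (\<xi> x)) * (?V (move \<xi> (x+1) x) - ?V \<xi>))
    = (real N - 1) * (\<eta> 1 + \<eta> (N-1)) - 2 * (\<Sum>x\<in>{1..<N}. \<eta> x)" .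
  have edges: "real N \<le> \<omega>L * ?u 1" "real N \<le> \<omega>R * ?u (N-1)"
  proof -
    have "real N / \<omega>L \<le> ?u 1" "real N / \<omega>R \<le> ?u (N-1)"
      using N \<omega> by (auto simp: site_potential_def intro!: add_nonneg_nonneg)
    then show "real N \<le> \<omega>L * ?u 1" "real N \<le> \<omega>R * ?u (N-1)"
      using \<omega> by (simp_all add: divide_le_eq mult.commute)
  qed
  have left: "\<omega>L * real (\<xi> 1) * (?V (move \<xi> 1 0) - ?V \<xi>) \<le> - (real N * \<eta> 1)"
    using occ[of 1] change[of 1 0] edges(1) N by (auto simp: \<eta>_def)
  have right: "\<omega>R * real (\<xi> (N-1)) * (?V (move \<xi> (N-1) N) - ?V \<xi>) \<le> - (real N * \<eta> (N-1))"
  proof -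
    have "N - 1 \<in> {1..<N}" "N - 1 \<noteq> N" using N by auto
    from occ[OF this(1)] change[OF this] edges(2) show ?thesis by (auto simp: \<eta>_def)
  qed
  have "\<eta> 1 \<ge> 0" "\<eta> (N-1) \<ge> 0" by (simp_all add: \<eta>_def)
  have "dual_generator N \<omega>L \<omega>R ?V \<xi> \<le> (real N - 1) * (\<eta> 1 + \<eta> (N-1)) - 2 * (\<Sum>x\<in>{1..<N}. \<eta> x)
      + - (real N * \<eta> 1) + - (real N * \<eta> (N-1))"
    unfolding dual_generator_def bulk using left right by linarith
  also have "\<dots> \<le> - (\<Sum>x\<in>{1..<N}. \<eta> x)"
  proof -
    have "(\<Sum>x\<in>{1..<N}. \<eta> x) \<ge> 0" by (intro sum_nonneg) (simp add: \<eta>_def)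
    then show ?thesis using \<open>\<eta> 1 \<ge> 0\<close> \<open>\<eta> (N-1) \<ge> 0\<close> by (simp add: algebra_simps)
  qed
  also have "\<dots> \<le> - indicator (- absorbed N) \<xi>"
  proof (cases "\<xi> \<in> absorbed N")
    case True
    then show ?thesis by (auto simp: \<eta>_def intro!: sum_nonneg)
  next
    case False
    then obtain y where y: "y \<in> {1..<N}" "\<xi> y \<noteq> 0" by (auto simp: absorbed_def)
    have "1 \<le> \<eta> y" using y(2) by (simp add: \<eta>_def)
    also have "\<dots> \<le> (\<Sum>x\<in>{1..<N}. \<eta> x)"
      using y(1) by (intro member_le_sum) (auto simp: \<eta>_def)
    finally show ?thesis using False by simp
  qed
  finally show ?thesis unfolding dual_generator_uminus by simp
qed

lemma potential_nonneg: "\<omega>L > 0 \<Longrightarrow> \<omega>R > 0 \<Longrightarrow> 0 \<le> potential N \<omega>L \<omega>R \<xi>"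
  unfolding potential_def site_potential_def
  by (intro sum_nonneg mult_nonneg_nonneg add_nonneg_nonneg) auto

lemma bounded_potential: "bounded (potential N \<omega>L \<omega>R ` configs N)"
proof (rule bounded_on_configs)
  fix \<xi> assume \<xi>: "\<xi> \<in> configs N"
  have "min (\<xi> y) 1 = \<xi> y" if "y \<in> {1..<N}" for y
    using configs_bulk[OF \<xi> that] by auto
  then show "potential N \<omega>L \<omega>R (\<lambda>y. if y \<le> N then min (\<xi> y) 1 else 0) = potential N \<omega>L \<omega>R \<xi>"
    unfolding potential_def by (intro sum.cong) auto
qed

section \<open>The absorption probability\<close>

text \<open>
  At an integer time \<open>n\<close>, the configurations that are absorbed with \<open>k\<close> particles at \<open>N\<close> bound the event
  from below, and adding those that are not yet absorbed bounds it from above. The harmonic function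
  is the indicator of the former on absorbed configurations, so its expectation, which does not depend
  on \<open>n\<close>, differs from the sought probability by at most a constant multiple of the probability of non-absorption.
\<close>

theorem lemma3p3:
  fixes N k :: nat and \<omega>L \<omega>R :: real
    and h :: "nat \<Rightarrow> real" and x :: "nat \<Rightarrow> nat"
    and M :: "'w measure" and \<xi> :: "real \<Rightarrow> 'w \<Rightarrow> config"
  assumes "N \<ge> 2" and "\<omega>L > 0" and "\<omega>R > 0"
    and "h 0 = 0"
    and "\<And>y. y \<in> {1..N-1} \<Longrightarrow> h y = 1 / \<omega>L + real y - 1"
    and "h N = 1 / \<omega>L + 1 / \<omega>R + real N - 2"
    and "strict_mono_on {1..k} x" and "x ` {1..k} \<subseteq> {1..N-1}"
    and "dual_process N \<omega>L \<omega>R (x ` {1..k}) M \<xi>"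
  shows "\<P>(w in M. limit_config \<xi> w N = k)
           = (\<Prod>i = 1..k. (h (x i) - (real i - 1)) / (h N - (real i - 1)))"
proof -
  note N = assms(1) and \<omega> = assms(2,3)
  define S L \<xi>0 where "S = configs N" and "L = dual_generator N \<omega>L \<omega>R"
    and "\<xi>0 = (indicator (x ` {1..k}) :: config)"
  have "{1..N-1} = {1..<N}" using N by auto
  with assms(8) have J: "x ` {1..k} \<subseteq> {1..<N}" by simp
  have mp: "markov_process S L \<xi>0 M \<xi>"
    using assms(9) by (simp add: dual_process_def S_def L_def \<xi>0_def)
  have M: "prob_space M" and X: "\<And>t. t \<ge> 0 \<Longrightarrow> \<xi> t \<in> measurable M (count_space S)"
    and cadlag: "\<And>w. w \<in> space M \<Longrightarrow> cadlag_path S (\<lambda>t. \<xi> t w)"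
    and X0: "AE w in M. \<xi> 0 w = \<xi>0"
    using mp unfolding markov_process_def by simp_all
  obtain P where P: "markov_semigroup S P" and gen: "has_generator S P L"
    and markov: "has_markov_property S P M \<xi>"
    using mp unfolding markov_process_def by blast
  interpret prob_space M by (rule M)

  have \<xi>0_S: "\<xi>0 \<in> S"
    using J by (auto simp: S_def configs_def \<xi>0_def indicator_def)
  let ?T = "{\<zeta>. sum \<zeta> {0..N} = k}" and ?B = "absorbed N" and ?F = "absorb_right N h"
  have \<xi>0_T: "\<xi>0 \<in> ?T"
  proof -
    have "{0..N} \<inter> x ` {1..k} = x ` {1..k}" using J by auto
    then show ?thesis
      using sum_indicator_eq_card[of "{0..N}" "x ` {1..k}"]
        card_image[OF strict_mono_on_imp_inj_on[OF assms(7)]]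
      by (simp add: \<xi>0_def)
  qed

  have sub_T: "0 \<le> L (indicator ?T) \<zeta>" if "\<zeta> \<in> S" for \<zeta>
    unfolding L_def
  proof (rule dual_generator_indicator_nonneg)
    fix p q assume *: "\<zeta> \<in> ?T" "p \<in> {1..<N}" "\<zeta> p \<ge> 1" "q \<le> N" "q \<noteq> p"
    then show "move \<zeta> p q \<in> ?T"
      using sum_move[of "{0..N}" \<zeta> p q] by simp
  qed (use N \<omega> that in \<open>auto simp: S_def\<close>)
  have sub_absorbing: "0 \<le> L (indicator A) \<zeta>" if "\<zeta> \<in> S" "A \<subseteq> ?B" for A \<zeta>
    unfolding L_def
  proof (rule dual_generator_indicator_nonneg)
    fix p q assume "\<zeta> \<in> A" "p \<in> {1..<N}" "\<zeta> p \<ge> 1"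
    then show "move \<zeta> p q \<in> A"
      using that(2) by (auto simp: absorbed_def)
  qed (use N \<omega> that in \<open>auto simp: S_def\<close>)

  define p where "p t = P t \<xi>0" for t
  have p_S: "set_pmf (p t) \<subseteq> S" if "t \<ge> 0" for t
    unfolding p_def by (rule markov_semigroupD(1)[OF P \<xi>0_S that])
  have p_T: "set_pmf (p t) \<subseteq> ?T" if "t \<ge> 0" for t
    unfolding p_def by (rule semigroup_stays_in[OF P gen sub_T \<xi>0_S \<xi>0_T that])

  have F_bounded: "bounded (?F ` S)" unfolding S_def by (rule bounded_absorb_right)
  then obtain C where C: "\<And>\<zeta>. \<zeta> \<in> S \<Longrightarrow> \<bar>?F \<zeta>\<bar> \<le> C" by (auto simp: bounded_iff)
  have EF: "expect_pmf (p t) ?F = ?F \<xi>0" if t: "t \<ge> 0" for t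
  proof (rule antisym)
    have harmonic: "L ?F \<zeta> = 0" if "\<zeta> \<in> S" for \<zeta>
      unfolding L_def using absorb_right_harmonic[OF N \<omega> assms(5,6)] that by (simp add: S_def)
    show "?F \<xi>0 \<le> expect_pmf (p t) ?F"
      unfolding p_def by (rule expect_subharmonic[OF P gen F_bounded _ \<xi>0_S t]) (simp add: harmonic)
    have "bounded ((\<lambda>\<zeta>. - ?F \<zeta>) ` S)" using F_bounded by (simp add: bounded_iff)
    moreover have "L (\<lambda>\<zeta>. - ?F \<zeta>) \<zeta> = 0" if "\<zeta> \<in> S" for \<zeta>
      using harmonic[OF that] by (simp add: L_def dual_generator_uminus)
    ultimately have "- ?F \<xi>0 \<le> expect_pmf (P t \<xi>0) (\<lambda>\<zeta>. - ?F \<zeta>)"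
      by (intro expect_subharmonic[OF P gen _ _ \<xi>0_S t]) auto
    then show "expect_pmf (p t) ?F \<le> ?F \<xi>0" by (simp add: p_def)
  qed

  have not_absorbed: "t * measure_pmf.prob (p t) (- ?B) \<le> potential N \<omega>L \<omega>R \<xi>0" if t: "t \<ge> 0" for t
    unfolding p_def
  proof (rule prob_not_absorbed_le[OF P gen _ _ _ _ \<xi>0_S t])
    show "bounded (potential N \<omega>L \<omega>R ` S)" unfolding S_def by (rule bounded_potential)
    show "0 \<le> potential N \<omega>L \<omega>R \<zeta>" for \<zeta> by (rule potential_nonneg[OF \<omega>])
    show "indicator (- ?B) \<zeta> \<le> L (\<lambda>z. - potential N \<omega>L \<omega>R z) \<zeta>" if "\<zeta> \<in> S" for \<zeta>
      unfolding L_def using potential_drift[OF N \<omega>] that by (simp add: S_def)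
    show "0 \<le> L (indicator ?B) \<zeta>" if "\<zeta> \<in> S" for \<zeta> by (rule sub_absorbing[OF that order_refl])
  qed

  let ?E = "{w \<in> space M. limit_config \<xi> w N = k}"
  have E: "?E \<in> events"
  proof -
    have "(\<lambda>w. limit_config \<xi> w N) \<in> measurable M (count_space UNIV)"
      unfolding limit_config_def by (rule measurable_Lim_path[OF X cadlag])
    then show ?thesis by (rule event_of_discrete)
  qed
  have frozen: "AE w in M. \<forall>n::nat. \<xi> n w \<in> ?B \<longrightarrow> (\<forall>t\<ge>n. \<xi> t w = \<xi> n w)"
  proof (rule absorbed_path_constant[OF M X cadlag markov])
    show "countable S" unfolding S_def by (rule countable_configs)
    show "set_pmf (P t b) \<subseteq> {b}" if "b \<in> ?B" "b \<in> S" "t \<ge> 0" for b t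
      using that by (intro semigroup_stays_in[OF P gen sub_absorbing]) auto
  qed
  have lim: "AE w in M. \<forall>n::nat. \<xi> n w \<in> ?B \<longrightarrow> limit_config \<xi> w N = \<xi> n w N"
    using frozen
  proof eventually_elim
    case (elim w)
    show ?case
    proof (intro allI impI)
      fix n :: nat assume "\<xi> n w \<in> ?B"
      then have "\<forall>t\<ge>real n. \<xi> t w N = \<xi> n w N" using elim by metis
      then have "((\<lambda>t. \<xi> t w N) \<longlongrightarrow> \<xi> n w N) at_top"
        unfolding tendsto_discrete eventually_at_top_linorder by blast
      then show "limit_config \<xi> w N = \<xi> n w N"
        unfolding limit_config_def by (rule tendsto_Lim[OF trivial_limit_at_top_linorder])
    qed
  qed

  have marginal: "\<P>(w in M. \<xi> t w \<in> A) = measure_pmf.prob (p t) A" if "t \<ge> 0" for t A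
    unfolding p_def using that
    by (intro markov_marginal[OF M X markov P X0 \<xi>0_S]) (auto simp: S_def countable_configs)
  have bound: "\<bar>prob ?E - ?F \<xi>0\<bar> \<le> (1 + C) * measure_pmf.prob (p n) (- ?B)" for n :: nat
  proof -
    let ?D = "{\<zeta> \<in> ?B. \<zeta> N = k}"
    have n: "real n \<ge> 0" by simp
    have event: "{w \<in> space M. \<xi> n w \<in> A} \<in> events" for A
      by (rule event_of_discrete[OF X[OF n]])
    have "prob {w \<in> space M. \<xi> n w \<in> ?D} \<le> prob ?E"
    proof (rule finite_measure_mono_AE[OF _ E])
      show "AE w in M. w \<in> {w \<in> space M. \<xi> n w \<in> ?D} \<longrightarrow> w \<in> ?E"
        using lim by eventually_elim auto
    qed
    then have lower: "measure_pmf.prob (p n) ?D \<le> prob ?E" by (simp only: marginal[OF n])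
    have "prob ?E \<le> prob {w \<in> space M. \<xi> n w \<in> ?D \<union> - ?B}"
    proof (rule finite_measure_mono_AE[OF _ event])
      show "AE w in M. w \<in> ?E \<longrightarrow> w \<in> {w \<in> space M. \<xi> n w \<in> ?D \<union> - ?B}"
        using lim by eventually_elim auto
    qed
    also have "\<dots> \<le> measure_pmf.prob (p n) ?D + measure_pmf.prob (p n) (- ?B)"
      unfolding marginal[OF n] by (rule measure_Un_le) auto
    finally have upper: "prob ?E \<le> measure_pmf.prob (p n) ?D + measure_pmf.prob (p n) (- ?B)" .

    have "\<bar>expect_pmf (p n) ?F - measure_pmf.prob (p n) ?D\<bar> \<le> C * measure_pmf.prob (p n) (- ?B)"
    proof -
      have i: "integrable (p n) ?F" by (rule integrable_pmf_bounded_on[OF p_S[OF n] F_bounded])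
      have close: "\<bar>?F \<zeta> - indicator ?D \<zeta>\<bar> \<le> C * indicator (- ?B) \<zeta>"
        if "\<zeta> \<in> set_pmf (p n)" for \<zeta>
      proof (cases "\<zeta> \<in> ?B")
        case True
        moreover have "sum \<zeta> {0..N} = k" using p_T[OF n] that by blast
        ultimately show ?thesis using absorb_right_absorbed[of \<zeta> N k h] N by simp
      next
        case False
        then show ?thesis using C[of \<zeta>] p_S[OF n] that by auto
      qed
      have ind: "integrable (p n) (indicator A :: config \<Rightarrow> real)" for A
        by (rule integrable_pmf_bounded_on[OF subset_UNIV bounded_indicator_image])
      have "expect_pmf (p n) (\<lambda>\<zeta>. ?F \<zeta> - indicator ?D \<zeta>) \<le> expect_pmf (p n) (\<lambda>\<zeta>. C * indicator (- ?B) \<zeta>)"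
        using i ind by (intro integral_mono_AE) (simp_all add: AE_measure_pmf_iff abs_le_D1[OF close])
      moreover have "expect_pmf (p n) (\<lambda>\<zeta>. - (?F \<zeta> - indicator ?D \<zeta>)) \<le> expect_pmf (p n) (\<lambda>\<zeta>. C * indicator (- ?B) \<zeta>)"
        using i ind abs_le_D2[OF close] by (intro integral_mono_AE) (simp_all add: AE_measure_pmf_iff)
      ultimately show ?thesis using i ind by (simp add: abs_le_iff)
    qed
    then show ?thesis using lower upper EF[OF n] by (simp add: algebra_simps abs_le_iff)
  qed

  have "\<bar>prob ?E - ?F \<xi>0\<bar> \<le> 0"
  proof (rule tendsto_lowerbound[OF _ _ sequentially_bot])
    show "\<forall>\<^sub>F n in sequentially. \<bar>prob ?E - ?F \<xi>0\<bar> \<le> (1 + C) * (potential N \<omega>L \<omega>R \<xi>0 / real n)"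
      using eventually_gt_at_top[of 0]
    proof eventually_elim
      case (elim n)
      have "0 \<le> C" using C[OF \<xi>0_S] by linarith
      moreover have "measure_pmf.prob (p n) (- ?B) \<le> potential N \<omega>L \<omega>R \<xi>0 / real n"
        using not_absorbed[of "real n"] elim by (simp add: field_simps)
      ultimately have "(1 + C) * measure_pmf.prob (p n) (- ?B) \<le> (1 + C) * (potential N \<omega>L \<omega>R \<xi>0 / real n)"
        by (intro mult_left_mono) auto
      with bound[of n] show ?case by (rule order_trans)
    qed
    have "(\<lambda>n. potential N \<omega>L \<omega>R \<xi>0 / real n) \<longlonglongrightarrow> 0" by (rule lim_const_over_n)
    then show "(\<lambda>n. (1 + C) * (potential N \<omega>L \<omega>R \<xi>0 / real n)) \<longlonglongrightarrow> 0"
      by (rule tendsto_mult_right_zero)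
  qed
  then have "prob ?E = ?F \<xi>0" by simp
  also have "\<dots> = (\<Prod>i = 1..k. (h (x i) - (real i - 1)) / (h N - (real i - 1)))"
    unfolding \<xi>0_def by (rule absorb_right_initial[OF assms(7) J])
  finally show ?thesis .
qed

end
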